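(* Consider a Branching Markov Chain on a countable state space $X$ with irreducible underlying Markov chain $(X,P)$, $P=(p(x,y))_{x,y\in X}$, and offspring distributions $(\mu_k(x))_{k\ge 1}$, $x\in X$, with means $m(x)=\sum_{k\ge1}k\mu_k(x)<\infty$. Suppose that $m(y)>1$ for some $y\in X$. If there exists a strictly positive function $f:X\to\mathbb{R}$ such that $$Pf(x)\le \frac{f(x)}{m(x)}\qquad\text{for all } x\in X,$$ then the Branching Markov Chain is transient.
   Context: Let $X$ be a countable set and $P=(p(x,y))_{x,y\in X}$ an irreducible stochastic transition kernel on $X$; $P$ acts on functions $f:X\to\mathbb{R}$ by $Pf(x)=\sum_{y}p(x,y)f(y)$. For each $x\in X$ let $\mu_1(x),\mu_2(x),\ldots$ be non-negative numbers with $\sum_{k=1}^\infty\mu_k(x)=1$ and $m(x):=\sum_{k=1}^\infty k\mu_k(x)<\infty$ (so every particle has at least one offspring). Branching Markov Chain (BMC): at time $0$ there is one particle at a starting position $x_s\in X$. At each time step, each particle, being at some position $x$, generates $k$ offspring particles at $x$ with probability $\mu_k(x)$ ($k=1,2,\ldots$) and dies; each of the offspring particles then moves independently one step according to $P$. All particles branch and move independently of the other particles and of the previous history of the process. Let $\eta(n)$ be the number of particles at time $n$ and $x_1(n),\ldots,x_{\eta(n)}(n)$ their positions. Write $\mathbb{P}_x$ for the law of the process started with $x_s=x$, and set $$\alpha(x)=\mathbb{P}_x\Big(\sum_{n=1}^\infty\sum_{i=1}^{\eta(n)}\mathbf{1}_{\{x_i(n)=x\}}=\infty\Big).$$ The BMC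 is called transient if $\alpha(x)=0$ for all $x\in X$. *)

theory Defs
  imports "HOL-Probability.Probability"
begin

text \<open>
  The state space is a countable type, transition kernels are functions to
  \<^typ>\<open>'a pmf\<close>, so \<open>p(x,y)\<close> is \<^term>\<open>pmf (p x) y\<close>, and \<open>\<mu>\<^sub>k(x)\<close> is \<^term>\<open>pmf (\<mu> x) k\<close>.
\<close>

primrec nstep :: "('a \<Rightarrow> 'a pmf) \<Rightarrow> nat \<Rightarrow> 'a \<Rightarrow> 'a pmf" where
  "nstep p 0 x = return_pmf x"
| "nstep p (Suc n) x = bind_pmf (p x) (nstep p n)"

definition irreducible_kernel :: "('a \<Rightarrow> 'a pmf) \<Rightarrow> bool" where
  "irreducible_kernel p \<longleftrightarrow> (\<forall>x y. \<exists>n. pmf (nstep p n x) y > 0)"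

text \<open>
  The action \<open>Pf(x) = \<Sum>\<^sub>y p(x,y) f(y)\<close> on non-negative functions, with values in
  \<open>[0,\<infinity>]\<close>, so that a divergent sum is \<open>\<infinity>\<close>.
\<close>

definition kernel_op :: "('a \<Rightarrow> 'a pmf) \<Rightarrow> ('a \<Rightarrow> ennreal) \<Rightarrow> 'a \<Rightarrow> ennreal" where
  "kernel_op p f x = (\<integral>\<^sup>+y. f y \<partial>measure_pmf (p x))"

lemma kernel_op_eq_sum:
  "kernel_op p f x = (\<integral>\<^sup>+y. ennreal (pmf (p x) y) * f y \<partial>count_space UNIV)"
  by (simp add: kernel_op_def nn_integral_measure_pmf)

text \<open>The value is \<open>0\<close> if \<open>\<mu>(x)\<close> has infinite mean; finiteness has to be assumed separately.\<close>

definition mean_offspring :: "('a \<Rightarrow> nat pmf) \<Rightarrow> 'a \<Rightarrow> real" where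
  "mean_offspring \<mu> x = measure_pmf.expectation (\<mu> x) real"

text \<open>
  Law on trajectories of the time-homogeneous Markov chain with kernel \<open>K\<close> started in \<open>s\<close>,
  obtained from the Ionescu--Tulcea theorem. It is characterised by
  \<open>emeasure_chain_law\<close> below.
\<close>

definition chain_kernel :: "('s \<Rightarrow> 's pmf) \<Rightarrow> 's \<Rightarrow> nat \<Rightarrow> (nat \<Rightarrow> 's) \<Rightarrow> 's measure" where
  "chain_kernel K s n \<omega> = measure_pmf (case n of 0 \<Rightarrow> return_pmf s | Suc m \<Rightarrow> K (\<omega> m))"

definition chain_law :: "('s \<Rightarrow> 's pmf) \<Rightarrow> 's \<Rightarrow> (nat \<Rightarrow> 's) measure" where
  "chain_law K s =
     projective_family.lim UNIV
       (Ionescu_Tulcea.CI (chain_kernel K s) (\<lambda>_. count_space UNIV)) (\<lambda>_. count_space UNIV)"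

lemma Ionescu_Tulcea_chain_kernel:
  "Ionescu_Tulcea (chain_kernel K s) (\<lambda>_. count_space UNIV)"
proof (rule Ionescu_Tulcea.intro)
  fix i :: nat
  show "chain_kernel K s i \<in>
      measurable (PiM {0..<i} (\<lambda>_. count_space UNIV)) (subprob_algebra (count_space UNIV))"
  proof (cases i)
    case 0
    have "measure_pmf (return_pmf s) \<in> space (subprob_algebra (count_space UNIV))"
      using measure_pmf_in_subprob_algebra[of "return_pmf s"] by simp
    then show ?thesis
      unfolding 0 chain_kernel_def by simp
  next
    case (Suc m)
    have "(\<lambda>\<omega>. \<omega> m) \<in> measurable (PiM {0..<Suc m} (\<lambda>_. count_space UNIV)) (count_space UNIV)"
      by (rule measurable_component_singleton) simp
    moreover have "(\<lambda>t. measure_pmf (K t)) \<in>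
        measurable (count_space UNIV) (subprob_algebra (count_space UNIV))"
      using measure_pmf_in_subprob_algebra by auto
    ultimately show ?thesis
      unfolding Suc chain_kernel_def nat.case by (rule measurable_compose)
  qed
  show "prob_space (chain_kernel K s i \<omega>)" for \<omega>
    by (simp add: chain_kernel_def measure_pmf.prob_space_axioms)
qed

lemma
  shows prob_space_chain_law: "prob_space (chain_law K s)"
    and sets_chain_law: "sets (chain_law K s) = sets (PiM UNIV (\<lambda>_. count_space UNIV))"
    and space_chain_law: "space (chain_law K s) = UNIV"
proof -
  interpret Ionescu_Tulcea "chain_kernel K s" "\<lambda>_. count_space UNIV"
    by (rule Ionescu_Tulcea_chain_kernel)
  show "prob_space (chain_law K s)"
  proof
    have "emeasure PF.lim (PF.emb UNIV {} (space (PiM {} (\<lambda>_. count_space UNIV))))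
        = emeasure (CI {}) (space (PiM {} (\<lambda>_. count_space UNIV)))"
      by (rule lim) auto
    moreover have "emeasure (CI {}) (space (PiM {} (\<lambda>_. count_space UNIV))) = 1"
      using prob_space.emeasure_space_1[OF PF.prob_space_P, of "{}"]
      by (simp add: PF.space_P)
    ultimately show "emeasure (chain_law K s) (space (chain_law K s)) = 1"
      by (simp add: chain_law_def prod_emb_def space_PiM PF.space_lim vimage_def restrict_def)
  qed
  show "sets (chain_law K s) = sets (PiM UNIV (\<lambda>_. count_space UNIV))"
    by (simp add: chain_law_def)
  show "space (chain_law K s) = UNIV"
    by (simp add: chain_law_def space_PiM PF.space_lim)
qed

lemma emeasure_chain_law:
  fixes K :: "'s::countable \<Rightarrow> 's pmf"
  shows "emeasure (chain_law K s) {\<omega>. \<forall>i\<le>n. \<omega> i = z i} =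
    ennreal (indicator {s} (z 0) * (\<Prod>i<n. pmf (K (z i)) (z (Suc i))))"
proof -
  interpret Ionescu_Tulcea "chain_kernel K s" "\<lambda>_. count_space UNIV"
    by (rule Ionescu_Tulcea_chain_kernel)
  define u :: "nat \<Rightarrow> 's" where "u = (\<lambda>_. undefined)"
  define Z where "Z n = {restrict z {0..<n}}" for n
  have Z: "Z n \<in> sets (PiM {0..<n} (\<lambda>_. count_space UNIV))" for n
  proof -
    have "Z n = (\<Pi>\<^sub>E i\<in>{0..<n}. {z i})"
      unfolding Z_def by (subst PiE_singleton[symmetric, of _ "{0..<n}"]) (auto intro!: PiE_cong)
    then show ?thesis by (simp add: sets_PiM_I_finite)
  qed
  have u: "u \<in> space (PiM {0..<0} (\<lambda>_. count_space UNIV))"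
    by (simp add: u_def space_PiM)
  have C_step: "C 0 (Suc n) u (Z (Suc n)) =
      C 0 n u (Z n) * (chain_kernel K s n (restrict z {0..<n})) {z n}" for n
  proof -
    have "C 0 (Suc n) u (Z (Suc n)) = (\<integral>\<^sup>+\<omega>. eP n \<omega> (Z (Suc n)) \<partial>C 0 n u)"
      using measurable_C[of 0 n] u Z[of "Suc n"]
      by (simp, subst emeasure_bind[where N="PiM {0..<Suc n} (\<lambda>_. count_space UNIV)"])
         (auto simp: space_C sets_C cong: measurable_cong_sets)
    also have "\<dots> = (\<integral>\<^sup>+\<omega>. chain_kernel K s n (restrict z {0..<n}) {z n} * indicator (Z n) \<omega> \<partial>C 0 n u)"
    proof (rule nn_integral_cong)
      fix \<omega> assume "\<omega> \<in> space (C 0 n u)"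
      then have \<omega>: "\<omega> \<in> space (PiM {0..<n} (\<lambda>_. count_space UNIV))"
        using u by (simp add: space_C)
      then have ext: "\<omega> \<in> extensional {0..<n}"
        by (simp add: space_PiM PiE_def)
      have "(\<lambda>t. fun_upd \<omega> n t) -` Z (Suc n) = (if \<omega> \<in> Z n then {z n} else {})"
      proof -
        have "fun_upd \<omega> n t = restrict z {0..<Suc n} \<longleftrightarrow> t = z n \<and> \<omega> = restrict z {0..<n}" for t
        proof
          assume eq: "fun_upd \<omega> n t = restrict z {0..<Suc n}"
          have "\<omega> i = restrict z {0..<n} i" for i
            using fun_cong[OF eq, of i] ext by (cases "i = n") (auto simp: extensional_def)
          with fun_cong[OF eq, of n] show "t = z n \<and> \<omega> = restrict z {0..<n}"
            by auto
        qed (auto simp: fun_eq_iff)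
        then show ?thesis
          unfolding Z_def vimage_def singleton_iff by simp
      qed
      then show "eP n \<omega> (Z (Suc n)) =
          chain_kernel K s n (restrict z {0..<n}) {z n} * indicator (Z n) \<omega>"
        using emeasure_eP[OF \<omega> Z[of "Suc n"]]
        by (cases "\<omega> \<in> Z n") (simp_all, simp add: Z_def)
    qed
    also have "\<dots> = chain_kernel K s n (restrict z {0..<n}) {z n} * C 0 n u (Z n)"
      using Z[of n] u by (subst nn_integral_cmult_indicator) (auto simp: sets_C)
    finally show ?thesis by (simp add: mult.commute)
  qed
  have C_eq: "C 0 (Suc n) u (Z (Suc n)) =
      ennreal (indicator {s} (z 0) * (\<Prod>i<n. pmf (K (z i)) (z (Suc i))))" for n
  proof (induction n)
    case 0
    have "C 0 0 u (Z 0) = 1"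
      using Z[of 0] u by (simp add: Z_def u_def restrict_def)
    then show ?case
      unfolding C_step[of 0]
      by (simp add: chain_kernel_def emeasure_pmf_single indicator_def)
  next
    case (Suc n)
    show ?case
      unfolding C_step[of "Suc n"] Suc
      by (simp add: chain_kernel_def emeasure_pmf_single ennreal_mult' prod_nonneg mult.assoc)
  qed
  have "{\<omega>. \<forall>i\<le>n. \<omega> i = z i} = PF.emb UNIV {0..<Suc n} (Z (Suc n))"
  proof -
    have "\<omega> i = z i" if "restrict \<omega> {0..<Suc n} = restrict z {0..<Suc n}" "i \<le> n" for \<omega> i
      using fun_cong[OF that(1), of i] that(2) by simp
    moreover have "restrict \<omega> {0..<Suc n} = restrict z {0..<Suc n}" if "\<forall>i\<le>n. \<omega> i = z i" for \<omega>
      using that by (intro restrict_ext) simp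
    moreover have "PF.emb UNIV {0..<Suc n} (Z (Suc n)) =
        {\<omega>. restrict \<omega> {0..<Suc n} = restrict z {0..<Suc n}}"
      by (simp add: prod_emb_def Z_def vimage_def)
    ultimately show ?thesis
      by blast
  qed
  then have "emeasure (chain_law K s) {\<omega>. \<forall>i\<le>n. \<omega> i = z i} = CI {0..<Suc n} (Z (Suc n))"
    using lim[OF _ Z[of "Suc n"]] by (simp add: chain_law_def)
  also have "\<dots> = C 0 (Suc n) u (Z (Suc n))"
    using emeasure_CI[OF order_refl Z[of "Suc n"]] Z[of "Suc n"]
    by (subst (asm) prod_emb_id) (auto simp: u_def Z_def space_PiM PiE_iff simp del: C.simps)
  finally show ?thesis unfolding C_eq .
qed

text \<open>
  A configuration of the branching Markov chain is the list \<open>[x\<^sub>1(n), \<dots>, x\<^sub>\<eta>(n)]\<close> of the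
  positions of the particles alive at time \<open>n\<close>. The randomness of distinct particles in
  \<open>bmc_step\<close>, and of the moves of distinct children in \<^const>\<open>replicate_pmf\<close>, is independent.
\<close>

definition bmc_children :: "('a \<Rightarrow> nat pmf) \<Rightarrow> ('a \<Rightarrow> 'a pmf) \<Rightarrow> 'a \<Rightarrow> 'a list pmf" where
  "bmc_children \<mu> p x = bind_pmf (\<mu> x) (\<lambda>k. replicate_pmf k (p x))"

primrec bmc_step :: "('a \<Rightarrow> nat pmf) \<Rightarrow> ('a \<Rightarrow> 'a pmf) \<Rightarrow> 'a list \<Rightarrow> 'a list pmf" where
  "bmc_step \<mu> p [] = return_pmf []"
| "bmc_step \<mu> p (x # xs) =
     bind_pmf (bmc_children \<mu> p x) (\<lambda>ys. bind_pmf (bmc_step \<mu> p xs) (\<lambda>zs. return_pmf (ys @ zs)))"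

definition bmc_law :: "('a \<Rightarrow> nat pmf) \<Rightarrow> ('a \<Rightarrow> 'a pmf) \<Rightarrow> 'a \<Rightarrow> (nat \<Rightarrow> 'a list) measure" where
  "bmc_law \<mu> p x = chain_law (bmc_step \<mu> p) [x]"

definition num_visits :: "'a \<Rightarrow> (nat \<Rightarrow> 'a list) \<Rightarrow> ennreal" where
  "num_visits x \<omega> = (\<Sum>n. \<Sum>i<length (\<omega> (Suc n)). indicator {x} (\<omega> (Suc n) ! i))"

definition bmc_alpha :: "('a \<Rightarrow> nat pmf) \<Rightarrow> ('a \<Rightarrow> 'a pmf) \<Rightarrow> 'a \<Rightarrow> real" where
  "bmc_alpha \<mu> p x = measure (bmc_law \<mu> p x) {\<omega>. num_visits x \<omega> = \<infinity>}"

definition bmc_transient :: "('a \<Rightarrow> nat pmf) \<Rightarrow> ('a \<Rightarrow> 'a pmf) \<Rightarrow> bool" where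
  "bmc_transient \<mu> p \<longleftrightarrow> (\<forall>x. bmc_alpha \<mu> p x = 0)"

lemma sets_num_visits_infinite:
  "{\<omega>. num_visits x \<omega> = \<infinity>} \<in> sets (bmc_law \<mu> p x)"
proof -
  have "(\<lambda>\<omega>. \<Sum>i<length (\<omega> n). indicator {x} (\<omega> n ! i) :: ennreal)
      \<in> borel_measurable (PiM UNIV (\<lambda>_. count_space UNIV))" for n
    by (rule measurable_compose[where g="\<lambda>xs. \<Sum>i<length xs. indicator {x} (xs ! i)",
          OF measurable_component_singleton[of n UNIV]]) auto
  then have "num_visits x \<in> borel_measurable (PiM UNIV (\<lambda>_. count_space UNIV))"
    unfolding num_visits_def[abs_def] by (intro borel_measurable_suminf_order)
  from measurable_sets[OF this, of "{\<infinity>}"] show ?thesis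
    by (simp add: bmc_law_def sets_chain_law vimage_def space_PiM)
qed

end

theory Submission
  imports Defs
begin

text \<open>
  Fix \<open>r\<close> and let \<open>L g = m \<cdot> P g\<close>, and let \<open>G g x\<close> be the expectation of \<open>\<Prod> g(x\<^sub>i)\<close> over the
  children \<open>x\<^sub>i\<close> of one particle at \<open>x\<close>. Let \<open>F x\<close> be the expected number of particles that are
  frozen in \<open>r\<close> when every particle is stopped at its first visit to \<open>r\<close>. The supermartingale \<open>f\<close>
  yields \<open>F x \<le> f x / f r\<close> and \<open>L F \<le> F\<close>. The iterates \<open>G\<^sup>n (1 - F)\<close> increase to some \<open>1 - u\<close>, and
  \<open>u r\<close> bounds the probability of infinitely many visits to \<open>r\<close>. Bernoulli's inequality gives
  \<open>u \<le> L u\<close>. Waiting until all lines are frozen shows \<open>u \<le> u r \<cdot> F\<close>, with equality in \<open>r\<close>. Hence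
  the strong maximum principle gives \<open>u = u r \<cdot> F\<close> and \<open>L u = u\<close> everywhere. At a point \<open>y\<close> with
  \<open>m y > 1\<close>, Bernoulli's inequality is strict unless \<open>P u y = 0\<close>, so \<open>u y = 0\<close>, and then \<open>u\<close>
  vanishes identically by irreducibility.
\<close>

section \<open>Finite-dimensional distributions of a Markov chain\<close>

primrec path_pmf :: "('s \<Rightarrow> 's pmf) \<Rightarrow> nat \<Rightarrow> 's \<Rightarrow> 's list pmf" where
  "path_pmf K 0 s = return_pmf [s]"
| "path_pmf K (Suc n) s = bind_pmf (K s) (\<lambda>t. map_pmf ((#) s) (path_pmf K n t))"

lemma length_path_pmf: "xs \<in> set_pmf (path_pmf K n s) \<Longrightarrow> length xs = Suc n"
  by (induction n arbitrary: s xs) auto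

lemma pmf_path_pmf:
  "pmf (path_pmf K n s) (map z [0..<Suc n]) =
    indicator {s} (z 0) * (\<Prod>i<n. pmf (K (z i)) (z (Suc i)))"
proof (induction n arbitrary: s z)
  case 0
  then show ?case by (simp add: indicator_def)
next
  case (Suc n)
  have shift: "map z [0..<Suc (Suc n)] = z 0 # map (z \<circ> Suc) [0..<Suc n]"
    by (metis (no_types, lifting) list.map_comp list.simps(9) map_Suc_upt upt_conv_Cons zero_less_Suc)
  have "pmf (map_pmf ((#) s) q) (z 0 # xs) = indicator {s} (z 0) * pmf q xs" for q xs
  proof (cases "z 0 = s")
    case True
    then show ?thesis using pmf_map_inj'[of "(#) s" q xs] by simp
  next
    case False
    then have "z 0 # xs \<notin> set_pmf (map_pmf ((#) s) q)" by auto
    then show ?thesis using False by (simp add: pmf_eq_0_set_pmf)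
  qed
  then have "pmf (path_pmf K (Suc n) s) (map z [0..<Suc (Suc n)]) =
      measure_pmf.expectation (K s) (\<lambda>t. indicator {s} (z 0) *
        (\<Prod>i<n. pmf (K (z (Suc i))) (z (Suc (Suc i)))) * indicator {z 1} t)"
    unfolding shift path_pmf.simps pmf_bind
    by (intro Bochner_Integration.integral_cong) (auto simp: Suc indicator_def simp del: upt_Suc)
  also have "\<dots> = indicator {s} (z 0) *
        (\<Prod>i<n. pmf (K (z (Suc i))) (z (Suc (Suc i)))) * pmf (K s) (z 1)"
    by (simp add: pmf.rep_eq)
  finally show ?case
    unfolding prod.lessThan_Suc_shift by (simp add: indicator_def)
qed

text \<open>Lists over a countable type are countable, so comparing atoms suffices: the preimage of
  a list of length \<open>Suc n\<close> is a cylinder, that of any other list is empty.\<close>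

lemma distr_chain_law:
  fixes K :: "'s::countable \<Rightarrow> 's pmf"
  shows "(\<lambda>\<omega>. map \<omega> [0..<Suc n]) \<in> measurable (chain_law K s) (count_space UNIV)"
    and "distr (chain_law K s) (count_space UNIV) (\<lambda>\<omega>. map \<omega> [0..<Suc n]) = path_pmf K n s"
proof -
  let ?h = "\<lambda>\<omega>. map \<omega> [0..<Suc n]"
  have vimage: "?h -` {map z [0..<Suc n]} = {\<omega>. \<forall>i\<le>n. \<omega> i = z i}" for z :: "nat \<Rightarrow> 's"
    by (auto simp del: upt_Suc)
  have cyl: "{\<omega>. \<forall>i\<le>n. \<omega> i = z i} \<in> sets (chain_law K s)" for z :: "nat \<Rightarrow> 's"
  proof -
    have "{\<omega> \<in> space (PiM UNIV (\<lambda>_. count_space UNIV)). \<forall>i\<le>n. \<omega> i = z i}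
        \<in> sets (PiM UNIV (\<lambda>_. count_space UNIV))"
      by measurable
    then show ?thesis by (simp add: sets_chain_law space_PiM)
  qed
  have list: "xs = map (nth xs) [0..<Suc n]" if "length xs = Suc n" for xs :: "'s list"
    by (metis map_nth that)
  have vimage': "?h -` {xs} = {}" if "length xs \<noteq> Suc n" for xs :: "'s list"
    using that by auto
  have "?h -` {xs} \<in> sets (chain_law K s)" for xs :: "'s list"
    using list[of xs] vimage[of "nth xs"] vimage'[of xs] cyl[of "nth xs"]
    by (cases "length xs = Suc n") (simp_all del: upt_Suc)
  then show meas: "?h \<in> measurable (chain_law K s) (count_space UNIV)"
    by (simp add: measurable_count_space_eq2_countable space_chain_law del: upt_Suc)
  show "distr (chain_law K s) (count_space UNIV) ?h = path_pmf K n s"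
  proof (rule measure_eqI_countable[where A = UNIV])
    fix xs :: "'s list"
    have "emeasure (chain_law K s) (?h -` {xs}) = pmf (path_pmf K n s) xs"
    proof (cases "length xs = Suc n")
      case True
      then show ?thesis
        using emeasure_chain_law[of K s n "nth xs"] pmf_path_pmf[of K n s "nth xs"]
          vimage[of "nth xs"] list[of xs] by simp
    next
      case False
      then have "xs \<notin> set_pmf (path_pmf K n s)" by (auto dest: length_path_pmf)
      then show ?thesis using vimage'[OF False] by (simp add: set_pmf_iff del: upt_Suc)
    qed
    then show "emeasure (distr (chain_law K s) (count_space UNIV) ?h) {xs} =
        emeasure (path_pmf K n s) {xs}"
      using meas by (simp add: emeasure_distr space_chain_law emeasure_pmf_single del: upt_Suc)
  qed auto
qed

text \<open>The recursion peels off the first step, not the last, so that inductions over time can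
  vary the starting state.\<close>

primrec cylinder_prob :: "('s \<Rightarrow> 's pmf) \<Rightarrow> (nat \<Rightarrow> 's set) \<Rightarrow> nat \<Rightarrow> 's \<Rightarrow> ennreal" where
  "cylinder_prob K S 0 s = indicator (S 0) s"
| "cylinder_prob K S (Suc n) s =
     indicator (S 0) s * (\<integral>\<^sup>+t. cylinder_prob K (S \<circ> Suc) n t \<partial>measure_pmf (K s))"

lemma emeasure_path_pmf:
  "emeasure (path_pmf K n s) {xs. \<forall>i\<le>n. xs ! i \<in> S i} = cylinder_prob K S n s"
proof (induction n arbitrary: S s)
  case 0
  then show ?case by (simp add: indicator_def)
next
  case (Suc n)
  have "(\<forall>i\<le>Suc n. P i) \<longleftrightarrow> P 0 \<and> (\<forall>i\<le>n. P (Suc i))" for P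
    by (metis Suc_le_mono le0 not0_implies_Suc)
  then have "(#) s -` {xs. \<forall>i\<le>Suc n. xs ! i \<in> S i} =
      (if s \<in> S 0 then {xs. \<forall>i\<le>n. xs ! i \<in> (S \<circ> Suc) i} else {})"
    by simp
  then show ?case
    by (simp add: emeasure_bind_pmf emeasure_map_pmf Suc.IH[symmetric])
qed

lemma emeasure_chain_law_cylinder:
  fixes K :: "'s::countable \<Rightarrow> 's pmf"
  shows "emeasure (chain_law K s) {\<omega>. \<forall>i\<le>n. \<omega> i \<in> S i} = cylinder_prob K S n s"
proof -
  let ?h = "\<lambda>\<omega>. map \<omega> [0..<Suc n]"
  have "cylinder_prob K S n s = emeasure (distr (chain_law K s) (count_space UNIV) ?h)
      {xs. \<forall>i\<le>n. xs ! i \<in> S i}"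
    unfolding distr_chain_law(2) by (rule emeasure_path_pmf[symmetric])
  also have "\<dots> = emeasure (chain_law K s) (?h -` {xs. \<forall>i\<le>n. xs ! i \<in> S i})"
    using distr_chain_law(1)[of n K s]
    by (simp add: emeasure_distr space_chain_law del: upt_Suc)
  also have "?h -` {xs. \<forall>i\<le>n. xs ! i \<in> S i} = {\<omega>. \<forall>i\<le>n. \<omega> i \<in> S i}"
    by (auto simp del: upt_Suc simp: nth_map_upt)
  finally show ?thesis by simp
qed

section \<open>The generating functional of the branching mechanism\<close>

text \<open>Since the children move independently, the expected product of \<open>g\<close> over
  them is the generating function of \<open>\<mu> x\<close> at
  \<open>kernel_op p g x\<close>.\<close>

definition offspring_gf :: "('a \<Rightarrow> nat pmf) \<Rightarrow> ('a \<Rightarrow> 'a pmf) \<Rightarrow> ('a \<Rightarrow> ennreal) \<Rightarrow> 'a \<Rightarrow> ennreal" where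
  "offspring_gf \<mu> p g x = (\<integral>\<^sup>+k. kernel_op p g x ^ k \<partial>measure_pmf (\<mu> x))"

lemma nn_integral_prod_list_replicate_pmf:
  "(\<integral>\<^sup>+ys. prod_list (map g ys) \<partial>measure_pmf (replicate_pmf k q)) =
    (\<integral>\<^sup>+y. g y \<partial>measure_pmf q) ^ k" for g :: "'a \<Rightarrow> ennreal"
  by (induction k) (simp_all add: nn_integral_cmult nn_integral_multc)

text \<open>Branching property: distinct particles are independent, so the expectation factors over
  the parents.\<close>

lemma nn_integral_prod_list_bmc_step:
  "(\<integral>\<^sup>+ys. prod_list (map g ys) \<partial>measure_pmf (bmc_step \<mu> p xs)) =
    prod_list (map (offspring_gf \<mu> p g) xs)"
  by (induction xs)
    (simp_all add: nn_integral_cmult nn_integral_multc bmc_children_def offspring_gf_def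
      kernel_op_def nn_integral_prod_list_replicate_pmf)

lemma offspring_gf_mono:
  "(\<And>y. g y \<le> h y) \<Longrightarrow> offspring_gf \<mu> p g x \<le> offspring_gf \<mu> p h x"
  unfolding offspring_gf_def kernel_op_def
  by (intro nn_integral_mono power_mono_ennreal)

lemma offspring_gf_le_1:
  assumes "\<And>y. g y \<le> 1"
  shows "offspring_gf \<mu> p g x \<le> 1"
proof -
  have "offspring_gf \<mu> p g x \<le> offspring_gf \<mu> p (\<lambda>_. 1) x"
    by (rule offspring_gf_mono) (rule assms)
  then show ?thesis by (simp add: offspring_gf_def kernel_op_def measure_pmf.emeasure_space_1)
qed

section \<open>Monotone continuity of the generating functional\<close>

lemma SUP_mult_incseq_ennreal:
  fixes f g :: "nat \<Rightarrow> ennreal"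
  assumes "incseq f" "incseq g"
  shows "(SUP i. f i) * (SUP i. g i) = (SUP i. f i * g i)"
proof (rule antisym)
  have "f i * g j \<le> (SUP i. f i * g i)" for i j
    using assms by (intro SUP_upper2[of "max i j"] mult_mono) (auto intro: incseqD)
  then show "(SUP i. f i) * (SUP i. g i) \<le> (SUP i. f i * g i)"
    unfolding SUP_mult_left_ennreal SUP_mult_right_ennreal by (intro SUP_least)
  show "(SUP i. f i * g i) \<le> (SUP i. f i) * (SUP i. g i)"
    by (intro SUP_least mult_mono SUP_upper) auto
qed

lemma SUP_power_incseq_ennreal:
  fixes f :: "nat \<Rightarrow> ennreal"
  assumes "incseq f"
  shows "(SUP i. f i) ^ k = (SUP i. f i ^ k)"
proof (induction k)
  case (Suc k)
  have "incseq (\<lambda>i. f i ^ k)"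
    using assms by (intro incseq_SucI power_mono_ennreal) (auto dest: incseq_SucD)
  with assms Suc show ?case by (simp add: SUP_mult_incseq_ennreal)
qed simp

lemma kernel_op_SUP:
  assumes "incseq (g :: nat \<Rightarrow> 'a \<Rightarrow> ennreal)"
  shows "kernel_op p (\<lambda>y. SUP n. g n y) x = (SUP n. kernel_op p (g n) x)"
  unfolding kernel_op_def using assms by (intro nn_integral_monotone_convergence_SUP) auto

lemma offspring_gf_SUP:
  assumes "incseq g"
  shows "offspring_gf \<mu> p (\<lambda>y. SUP n. g n y) x = (SUP n. offspring_gf \<mu> p (g n) x)"
proof -
  have inc: "incseq (\<lambda>n. kernel_op p (g n) x)"
    using assms unfolding kernel_op_def
    by (intro incseq_SucI nn_integral_mono) (auto simp: incseq_Suc_iff le_fun_def)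
  then have "incseq (\<lambda>n k. kernel_op p (g n) x ^ k)"
    by (auto simp: incseq_Suc_iff le_fun_def intro!: power_mono_ennreal)
  then show ?thesis
    unfolding offspring_gf_def kernel_op_SUP[OF assms] SUP_power_incseq_ennreal[OF inc]
    by (intro nn_integral_monotone_convergence_SUP) auto
qed

section \<open>Bounding the probability of infinitely many visits\<close>

text \<open>
  Particles multiply independently, so the probability of avoiding \<open>r\<close> at the times
  \<open>n, \<dots>, n + j\<close> is a product over the initial particles. The hypotheses make \<open>g\<close> a lower bound for
  the probability of never visiting \<open>r\<close>.
\<close>

lemma cylinder_prob_avoid:
  fixes g :: "'a \<Rightarrow> ennreal"
  assumes "\<And>y. g y \<le> 1" "g r = 0" "\<And>y. g y \<le> offspring_gf \<mu> p g y"
  shows "prod_list (map ((offspring_gf \<mu> p ^^ n) g) xs) \<le>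
    cylinder_prob (bmc_step \<mu> p) (\<lambda>i. if n \<le> i then {ys. r \<notin> set ys} else UNIV) (n + j) xs"
proof (induction n arbitrary: xs)
  case 0
  \<comment> \<open>The product is at most the indicator of avoiding \<open>r\<close>: it never
    exceeds 1, and one particle in \<open>r\<close> makes it 0.\<close>
  have le_1: "prod_list (map g xs) \<le> 1" for xs
    by (induction xs) (auto intro!: mult_le_one simp: assms(1))
  have zero: "prod_list (map g xs) = 0" if "r \<in> set xs" for xs
    using that assms(2) by (force simp: prod_list_zero_iff)
  show ?case
  proof (induction j arbitrary: xs)
    case 0
    then show ?case using le_1[of xs] zero[of xs] by (auto simp: indicator_def)
  next
    case (Suc j)
    have mono: "prod_list (map g xs) \<le> prod_list (map (offspring_gf \<mu> p g) xs)"
      by (induction xs) (auto intro!: mult_mono assms(3))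
    also have "\<dots> = (\<integral>\<^sup>+ys. prod_list (map g ys) \<partial>measure_pmf (bmc_step \<mu> p xs))"
      by (rule nn_integral_prod_list_bmc_step[symmetric])
    also have "\<dots> \<le> (\<integral>\<^sup>+ys. cylinder_prob (bmc_step \<mu> p) (\<lambda>_. {ys. r \<notin> set ys}) j ys
        \<partial>measure_pmf (bmc_step \<mu> p xs))"
      using Suc by (intro nn_integral_mono) simp
    finally show ?case using zero[of xs] by (cases "r \<in> set xs") (auto simp: o_def)
  qed
next
  case (Suc n)
  have "prod_list (map ((offspring_gf \<mu> p ^^ Suc n) g) xs) =
      (\<integral>\<^sup>+ys. prod_list (map ((offspring_gf \<mu> p ^^ n) g) ys) \<partial>measure_pmf (bmc_step \<mu> p xs))"
    by (simp add: nn_integral_prod_list_bmc_step)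
  also have "\<dots> \<le> (\<integral>\<^sup>+ys. cylinder_prob (bmc_step \<mu> p)
      (\<lambda>i. if n \<le> i then {ys. r \<notin> set ys} else UNIV) (n + j) ys \<partial>measure_pmf (bmc_step \<mu> p xs))"
    by (intro nn_integral_mono Suc)
  finally show ?case by (simp add: o_def)
qed

lemma num_visits_finite:
  assumes "\<And>i. n \<le> i \<Longrightarrow> r \<notin> set (\<omega> i)"
  shows "num_visits r \<omega> < \<infinity>"
proof -
  define c :: "nat \<Rightarrow> ennreal" where
    "c i = (\<Sum>j<length (\<omega> (Suc i)). indicator {r} (\<omega> (Suc i) ! j))" for i
  have "c i = 0" if "i \<notin> {..<n}" for i
    using assms[of "Suc i"] that unfolding c_def
    by (intro sum.neutral) (auto simp: indicator_def)
  then have "num_visits r \<omega> = (\<Sum>i<n. c i)"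
    unfolding num_visits_def c_def[symmetric] by (intro suminf_finite) auto
  also have "\<dots> < \<infinity>"
    by (auto simp: c_def indicator_def less_top[symmetric])
  finally show ?thesis .
qed

text \<open>Having no particle in \<open>r\<close> from time \<open>n\<close> on leaves finitely
  many visits. This event is the decreasing limit of the events \<open>B j\<close>, whose
  probabilities share one lower bound.\<close>

lemma bmc_alpha_le:
  fixes g :: "'a::countable \<Rightarrow> ennreal"
  assumes "\<And>y. g y \<le> 1" "g r = 0" "\<And>y. g y \<le> offspring_gf \<mu> p g y"
  shows "(offspring_gf \<mu> p ^^ n) g r \<le> ennreal (1 - bmc_alpha \<mu> p r)"
proof -
  interpret prob_space "bmc_law \<mu> p r"
    unfolding bmc_law_def by (rule prob_space_chain_law)
  define B where "B j = {\<omega>. \<forall>i\<le>n+j. \<omega> i \<in> (if n \<le> i then {ys. r \<notin> set ys} else UNIV)}"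
    for j
  have meas: "B j \<in> sets (bmc_law \<mu> p r)" for j
  proof -
    have "{\<omega> \<in> space (PiM UNIV (\<lambda>_. count_space UNIV)).
        \<forall>i\<le>n+j. \<omega> i \<in> (if n \<le> i then {ys. r \<notin> set ys} else UNIV)}
        \<in> sets (PiM UNIV (\<lambda>_. count_space UNIV))"
      by measurable
    then show ?thesis by (simp add: B_def bmc_law_def sets_chain_law space_PiM)
  qed
  have "(offspring_gf \<mu> p ^^ n) g r \<le> emeasure (bmc_law \<mu> p r) (B j)" for j
    using cylinder_prob_avoid[OF assms, where n = n and j = j and xs = "[r]"]
    by (simp add: B_def bmc_law_def emeasure_chain_law_cylinder)
  then have "(offspring_gf \<mu> p ^^ n) g r \<le> (INF j. emeasure (bmc_law \<mu> p r) (B j))"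
    by (intro INF_greatest)
  also have "\<dots> = emeasure (bmc_law \<mu> p r) (\<Inter>j. B j)"
  proof (rule INF_emeasure_decseq)
    show "decseq B" by (auto simp: decseq_def B_def)
  qed (use meas in auto)
  also have "\<dots> \<le> emeasure (bmc_law \<mu> p r) (space (bmc_law \<mu> p r) - {\<omega>. num_visits r \<omega> = \<infinity>})"
  proof (rule emeasure_mono)
    have "num_visits r \<omega> < \<infinity>" if "\<omega> \<in> (\<Inter>j. B j)" for \<omega>
    proof (rule num_visits_finite)
      show "r \<notin> set (\<omega> i)" if "n \<le> i" for i
        using \<open>\<omega> \<in> (\<Inter>j. B j)\<close> that by (auto simp: B_def dest!: spec[of _ i])
    qed
    then show "(\<Inter>j. B j) \<subseteq> space (bmc_law \<mu> p r) - {\<omega>. num_visits r \<omega> = \<infinity>}"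
      by (fastforce simp: bmc_law_def space_chain_law less_top)
  qed (intro sets.Diff sets.top sets_num_visits_infinite)
  also have "\<dots> = ennreal (1 - bmc_alpha \<mu> p r)"
    unfolding emeasure_eq_measure bmc_alpha_def
    by (simp only: prob_compl[OF sets_num_visits_infinite])
  finally show ?thesis .
qed

section \<open>The strong maximum principle\<close>

lemma irreducible_kernel_closed:
  assumes "irreducible_kernel p" "x \<in> A" "\<And>y. y \<in> A \<Longrightarrow> set_pmf (p y) \<subseteq> A"
  shows "A = UNIV"
proof -
  have "set_pmf (nstep p n y) \<subseteq> A" if "y \<in> A" for n y
    using that by (induction n arbitrary: y) (use assms(3) in fastforce)+
  then have "z \<in> A" for z
    using assms(1,2) unfolding irreducible_kernel_def
    by (metis pmf_positive_iff subsetD)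
  then show ?thesis by auto
qed

text \<open>Subtracting the integrals, legitimate because that of \<open>f\<close> is finite, leaves
  a non-negative function with integral 0.\<close>

lemma nn_integral_pmf_eqD:
  assumes "\<And>y. f y \<le> g y" "(\<integral>\<^sup>+y. g y \<partial>measure_pmf q) \<le> (\<integral>\<^sup>+y. f y \<partial>measure_pmf q)"
    "(\<integral>\<^sup>+y. f y \<partial>measure_pmf q) < \<infinity>" "y \<in> set_pmf q"
  shows "f y = (g y :: ennreal)"
proof -
  have "(\<integral>\<^sup>+y. g y - f y \<partial>measure_pmf q) = (\<integral>\<^sup>+y. g y \<partial>measure_pmf q) - (\<integral>\<^sup>+y. f y \<partial>measure_pmf q)"
    using assms by (intro nn_integral_diff) auto
  also have "\<dots> = 0"
    using assms by (simp add: diff_eq_0_iff_ennreal order.strict_trans1)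
  finally have "AE y in measure_pmf q. g y - f y = 0"
    by (simp add: nn_integral_0_iff_AE)
  then show ?thesis
    using assms(1)[of y] assms(4) by (auto simp: AE_measure_pmf_iff diff_eq_0_iff_ennreal)
qed

lemma bernoulli_strict:
  fixes t :: real
  assumes "0 < t" "t \<le> 1" "2 \<le> k"
  shows "1 < (1 - t) ^ k + real k * t"
  using assms(3)
proof (induction k rule: dec_induct)
  case base
  then show ?case using assms by (simp add: power2_eq_square algebra_simps)
next
  case (step k)
  \<comment> \<open>The new excess over 1 is this non-negative product plus
    \<open>real k * (t * t)\<close>.\<close>
  have "(1 - t) * ((1 - t) ^ k + real k * t - 1) \<ge> 0"
    using step assms by (intro mult_nonneg_nonneg) auto
  moreover have "0 < real k * (t * t)"
    using step assms by auto
  ultimately show ?case by (simp add: algebra_simps)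
qed

text \<open>Bernoulli's inequality for \<open>(1 - t) ^ k\<close>, phrased through
  \<open>s + t = 1\<close> to avoid truncated subtraction. For \<open>k < 2\<close> equality always
  holds, hence the bound on \<open>k\<close> in the second part.\<close>

lemma bernoulli_ennreal:
  fixes s t :: ennreal
  assumes "s + t = 1"
  shows "1 \<le> s ^ k + of_nat k * t"
    and "2 \<le> k \<Longrightarrow> s ^ k + of_nat k * t = 1 \<Longrightarrow> t = 0"
proof -
  obtain a b where ab: "0 \<le> a" "0 \<le> b" "s = ennreal a" "t = ennreal b" "a + b = 1"
    using assms by (cases s; cases t) (auto simp flip: ennreal_plus simp: top_add add_top)
  then have a: "a = 1 - b" and "b \<le> 1" by auto
  then have eq: "s ^ k + of_nat k * t = ennreal ((1 - b) ^ k + real k * b)"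
    using ab by (simp add: a ennreal_power ennreal_plus ennreal_mult ennreal_of_nat_eq_real_of_nat)
  have "1 + real k * (- b) \<le> (1 + (- b)) ^ k"
    using ab by (intro Bernoulli_inequality) auto
  then show "1 \<le> s ^ k + of_nat k * t"
    unfolding eq by (simp flip: ennreal_1)
  show "t = 0" if "2 \<le> k" "s ^ k + of_nat k * t = 1"
  proof -
    have "(1 - b) ^ k + real k * b = 1"
      using that(2) unfolding eq by simp
    then show ?thesis
      using bernoulli_strict[of b k] \<open>0 \<le> b\<close> \<open>b \<le> 1\<close> \<open>t = ennreal b\<close> that(1)
      by (cases "b = 0") auto
  qed
qed

text \<open>Linear counterpart of \<open>offspring_gf\<close>: for finite mean offspring, the
  expected sum instead of product of \<open>g\<close> over the children of a particle at
  \<open>x\<close>.\<close>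

definition mean_op :: "('a \<Rightarrow> nat pmf) \<Rightarrow> ('a \<Rightarrow> 'a pmf) \<Rightarrow> ('a \<Rightarrow> ennreal) \<Rightarrow> 'a \<Rightarrow> ennreal" where
  "mean_op \<mu> p g x = ennreal (mean_offspring \<mu> x) * kernel_op p g x"

lemma mean_op_mono: "(\<And>y. g y \<le> h y) \<Longrightarrow> mean_op \<mu> p g x \<le> mean_op \<mu> p h x"
  unfolding mean_op_def kernel_op_def by (intro mult_left_mono nn_integral_mono) auto

lemma mean_op_add: "mean_op \<mu> p (\<lambda>y. g y + h y) x = mean_op \<mu> p g x + mean_op \<mu> p h x"
  by (simp add: mean_op_def kernel_op_def nn_integral_add distrib_left)

lemma mean_op_cmult: "mean_op \<mu> p (\<lambda>y. c * g y) x = c * mean_op \<mu> p g x"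
  by (simp add: mean_op_def kernel_op_def nn_integral_cmult mult.left_commute)

lemma mean_op_SUP:
  assumes "incseq g"
  shows "mean_op \<mu> p (\<lambda>y. SUP n. g n y) x = (SUP n. mean_op \<mu> p (g n) x)"
  unfolding mean_op_def kernel_op_SUP[OF assms] SUP_mult_left_ennreal ..

context
  fixes p :: "'a \<Rightarrow> 'a pmf" and \<mu> :: "'a \<Rightarrow> nat pmf" and x :: 'a
  assumes no_death: "pmf (\<mu> x) 0 = 0" and finite_mean: "integrable (measure_pmf (\<mu> x)) real"
begin

lemma nn_integral_offspring:
  "(\<integral>\<^sup>+k. of_nat k \<partial>measure_pmf (\<mu> x)) = ennreal (mean_offspring \<mu> x)"
  unfolding mean_offspring_def
  by (subst nn_integral_eq_integral[symmetric])
    (auto simp: finite_mean ennreal_of_nat_eq_real_of_nat intro!: nn_integral_cong)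

lemma mean_offspring_ge_1: "1 \<le> mean_offspring \<mu> x"
proof -
  have "(\<integral>\<^sup>+k. 1 \<partial>measure_pmf (\<mu> x)) \<le> (\<integral>\<^sup>+k. of_nat k \<partial>measure_pmf (\<mu> x))"
  proof (rule nn_integral_mono_AE)
    have "1 \<le> k" if "k \<in> set_pmf (\<mu> x)" for k
      using that no_death by (cases k) (auto simp: set_pmf_iff)
    then show "AE k in measure_pmf (\<mu> x). (1::ennreal) \<le> of_nat k"
      using of_nat_mono[of 1] by (fastforce simp: AE_measure_pmf_iff)
  qed
  then show ?thesis
    by (simp add: nn_integral_offspring measure_pmf.emeasure_space_1)
qed

lemma offspring_gf_add_mean_op:
  "offspring_gf \<mu> p h x + mean_op \<mu> p u x =
    (\<integral>\<^sup>+k. kernel_op p h x ^ k + of_nat k * kernel_op p u x \<partial>measure_pmf (\<mu> x))"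
  by (simp add: offspring_gf_def mean_op_def nn_integral_add nn_integral_multc
      nn_integral_offspring)

text \<open>Bernoulli's inequality is integrated against \<open>\<mu> x\<close>. In the equality
  case the integrand is 1 on the support of \<open>\<mu> x\<close>, and a mean above 1 puts some
  \<open>k \<ge> 2\<close> there.\<close>

lemma
  assumes "\<And>y. h y + u y = 1"
  shows one_le_offspring_gf_add_mean_op: "1 \<le> offspring_gf \<mu> p h x + mean_op \<mu> p u x"
    and kernel_op_eq_0: "offspring_gf \<mu> p h x + mean_op \<mu> p u x \<le> 1 \<Longrightarrow>
      1 < mean_offspring \<mu> x \<Longrightarrow> kernel_op p u x = 0"
proof -
  let ?b = "\<lambda>k. kernel_op p h x ^ k + of_nat k * kernel_op p u x"
  have sum: "kernel_op p h x + kernel_op p u x = 1"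
    unfolding kernel_op_def
    by (subst nn_integral_add[symmetric]) (auto simp: assms measure_pmf.emeasure_space_1)
  have one: "(\<integral>\<^sup>+k. 1 \<partial>measure_pmf (\<mu> x)) = (1::ennreal)"
    by (simp add: measure_pmf.emeasure_space_1)
  have "(\<integral>\<^sup>+k. 1 \<partial>measure_pmf (\<mu> x)) \<le> (\<integral>\<^sup>+k. ?b k \<partial>measure_pmf (\<mu> x))"
    by (intro nn_integral_mono bernoulli_ennreal sum)
  then show "1 \<le> offspring_gf \<mu> p h x + mean_op \<mu> p u x"
    unfolding offspring_gf_add_mean_op one .
  assume le: "offspring_gf \<mu> p h x + mean_op \<mu> p u x \<le> 1" and gt: "1 < mean_offspring \<mu> x"
  have eq: "?b k = 1" if "k \<in> set_pmf (\<mu> x)" for k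
    using le that unfolding offspring_gf_add_mean_op
    by (intro nn_integral_pmf_eqD[symmetric, where q = "\<mu> x"])
      (auto simp: bernoulli_ennreal sum one)
  have "\<exists>k\<in>set_pmf (\<mu> x). 2 \<le> k"
  proof (rule ccontr)
    assume "\<not> (\<exists>k\<in>set_pmf (\<mu> x). 2 \<le> k)"
    then have "AE k in measure_pmf (\<mu> x). of_nat k \<le> (1::ennreal)"
      by (fastforce simp: AE_measure_pmf_iff)
    then have "(\<integral>\<^sup>+k. of_nat k \<partial>measure_pmf (\<mu> x)) \<le> (\<integral>\<^sup>+k. 1 \<partial>measure_pmf (\<mu> x))"
      by (rule nn_integral_mono_AE)
    then show False using gt by (simp add: nn_integral_offspring one)
  qed
  then show "kernel_op p u x = 0"
    using eq bernoulli_ennreal(2)[OF sum] by blast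
qed

text \<open>The mean offspring is at least 1, so it cancels, and equality of the averages passes to
  the support of \<open>p x\<close>. This is how equality spreads in the maximum principle.\<close>

lemma mean_op_eq_on_support:
  assumes "\<And>y. f y \<le> g y" "mean_op \<mu> p g x \<le> mean_op \<mu> p f x" "mean_op \<mu> p f x < \<infinity>"
    "y \<in> set_pmf (p x)"
  shows "f y = g y"
proof (rule nn_integral_pmf_eqD[where f = f and g = g and q = "p x"])
  have m: "0 < ennreal (mean_offspring \<mu> x)" using mean_offspring_ge_1 by simp
  show "(\<integral>\<^sup>+y. g y \<partial>p x) \<le> (\<integral>\<^sup>+y. f y \<partial>p x)"
    using assms(2) m unfolding mean_op_def kernel_op_def by (simp add: ennreal_mult_le_mult_iff)
  show "(\<integral>\<^sup>+y. f y \<partial>p x) < \<infinity>"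
    using assms(3) m unfolding mean_op_def kernel_op_def by (auto simp: ennreal_mult_less_top)
qed (use assms in auto)

end

section \<open>Particles frozen at their first visit\<close>

text \<open>
  The expected number of particles frozen in \<open>r\<close> up to time \<open>n\<close>, where each line of descent stops at
  its first visit to \<open>r\<close>, time \<open>0\<close> included.
\<close>

primrec frozen :: "('a \<Rightarrow> nat pmf) \<Rightarrow> ('a \<Rightarrow> 'a pmf) \<Rightarrow> 'a \<Rightarrow> nat \<Rightarrow> 'a \<Rightarrow> ennreal" where
  "frozen \<mu> p r 0 = indicator {r}"
| "frozen \<mu> p r (Suc n) = (\<lambda>x. if x = r then 1 else mean_op \<mu> p (frozen \<mu> p r n) x)"

lemma frozen_root [simp]: "frozen \<mu> p r n r = 1"
  by (cases n) auto

lemma incseq_frozen: "incseq (frozen \<mu> p r)"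
proof (rule incseq_SucI)
  show "frozen \<mu> p r n \<le> frozen \<mu> p r (Suc n)" for n
  proof (induction n)
    case (Suc n)
    then show ?case by (auto simp: le_fun_def intro!: mean_op_mono)
  qed (auto simp: le_fun_def indicator_def)
qed

theorem theorem3p1:
  fixes p :: "'a::countable \<Rightarrow> 'a pmf" and \<mu> :: "'a \<Rightarrow> nat pmf" and f :: "'a \<Rightarrow> real"
  assumes "irreducible_kernel p"
    and "\<And>x. pmf (\<mu> x) 0 = 0"
    and "\<And>x. integrable (measure_pmf (\<mu> x)) real"
    and "\<exists>y. mean_offspring \<mu> y > 1"
    and "\<And>x. f x > 0"
    and "\<And>x. kernel_op p (\<lambda>y. ennreal (f y)) x \<le> ennreal (f x / mean_offspring \<mu> x)"
  shows "bmc_transient \<mu> p"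
  unfolding bmc_transient_def
proof
  fix r :: 'a
  let ?L = "mean_op \<mu> p" and ?G = "offspring_gf \<mu> p"
  \<comment> \<open>Dividing by \<open>f r\<close> gives \<open>\<phi> r = 1\<close>, the value of
    \<open>frozen\<close> in \<open>r\<close>, so that \<open>\<phi>\<close> can dominate
    \<open>frozen\<close>.\<close>
  define \<phi> where "\<phi> x = ennreal (f x / f r)" for x
  have super_\<phi>: "?L \<phi> x \<le> \<phi> x" for x
  proof -
    let ?m = "mean_offspring \<mu> x"
    have m: "1 \<le> ?m" by (intro mean_offspring_ge_1 assms)
    have "\<phi> = (\<lambda>y. ennreal (1 / f r) * ennreal (f y))"
      by (subst ennreal_mult[symmetric]) (auto simp: \<phi>_def less_imp_le assms(5))
    then have "?L \<phi> x = ennreal (1 / f r) * (ennreal ?m * kernel_op p (\<lambda>y. ennreal (f y)) x)"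
      by (simp add: mean_op_cmult) (simp add: mean_op_def)
    also have "\<dots> \<le> ennreal (1 / f r) * (ennreal ?m * ennreal (f x / ?m))"
      by (intro mult_left_mono assms) auto
    also have "\<dots> = \<phi> x"
      using m assms(5)[of x] assms(5)[of r] by (simp add: \<phi>_def flip: ennreal_mult)
    finally show ?thesis .
  qed
  have \<phi>_r: "\<phi> r = 1" using assms(5)[of r] by (simp add: \<phi>_def)

  \<comment> \<open>Expected number of frozen particles\<close>
  define F where "F x = (SUP n. frozen \<mu> p r n x)" for x
  have "frozen \<mu> p r n x \<le> \<phi> x" for n x
  proof (induction n arbitrary: x)
    case (Suc n)
    then have "?L (frozen \<mu> p r n) x \<le> ?L \<phi> x" by (rule mean_op_mono)
    also note super_\<phi>
    finally show ?case by (simp add: \<phi>_r)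
  qed (simp add: indicator_def \<phi>_r)
  then have F_le: "F x \<le> \<phi> x" for x unfolding F_def by (intro SUP_least)
  have F_fin: "F x < \<infinity>" for x using F_le[of x] by (auto simp: \<phi>_def le_less_trans)
  have F_r: "F r = 1" by (simp add: F_def)
  have super_F: "?L F x \<le> F x" for x
  proof (cases "x = r")
    \<comment> \<open>In \<open>r\<close> the value of \<open>frozen\<close> is set to 1 and not
      produced by \<open>?L\<close>, so the bound has to come from \<open>\<phi>\<close>.\<close>
    case True
    then show ?thesis using mean_op_mono[of F \<phi> \<mu> p r] F_le super_\<phi>[of r] by (simp add: F_r \<phi>_r)
  next
    case False
    have "?L F x = (SUP n. ?L (frozen \<mu> p r n) x)"
      unfolding F_def by (rule mean_op_SUP[OF incseq_frozen])
    also have "\<dots> = (SUP n. frozen \<mu> p r (Suc n) x)" using False by simp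
    also have "\<dots> \<le> F x" unfolding F_def by (intro SUP_least SUP_upper) auto
    finally show ?thesis .
  qed

  \<comment> \<open>Subtraction truncates: \<open>F\<close> may exceed 1, and there \<open>g\<close>
    is 0. Thus \<open>1 - g\<close> is the minimum of \<open>F\<close> and 1.\<close>
  define g where "g x = 1 - F x" for x
  have g_le: "g x \<le> 1" and g_r: "g r = 0" for x
    by (simp_all add: g_def F_r)
  have g_sub: "g x \<le> ?G g x" for x
  proof -
    have "1 \<le> ?G g x + ?L (\<lambda>y. 1 - g y) x"
      using g_le by (intro one_le_offspring_gf_add_mean_op assms) (simp add: add_diff_inverse_ennreal)
    also have "?L (\<lambda>y. 1 - g y) x \<le> ?L F x"
    proof (rule mean_op_mono)
      show "1 - g y \<le> F y" for y
        unfolding g_def by (auto simp: ennreal_minus_le_iff diff_add_self_ennreal)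
    qed
    also note super_F
    finally show ?thesis unfolding g_def by (simp add: ennreal_minus_le_iff add.commute)
  qed

  \<comment> \<open>Monotone limit of the iterates of \<open>?G\<close>\<close>
  define h where "h x = (SUP n. (?G ^^ n) g x)" for x
  have h_le_alpha: "h r \<le> ennreal (1 - bmc_alpha \<mu> p r)"
    unfolding h_def by (intro SUP_least bmc_alpha_le g_le g_r g_sub)
  have inc: "incseq (\<lambda>n. (?G ^^ n) g)"
  proof (rule incseq_SucI)
    show "(?G ^^ n) g \<le> (?G ^^ Suc n) g" for n
      by (induction n) (auto simp: le_fun_def g_sub intro!: offspring_gf_mono)
  qed
  have h_le_1: "h x \<le> 1" for x
    unfolding h_def
  proof (rule SUP_least)
    show "(?G ^^ n) g x \<le> 1" for n
      by (induction n arbitrary: x) (auto simp: g_le intro!: offspring_gf_le_1)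
  qed
  have G_h: "?G h x \<le> h x" for x
  proof -
    have "?G h x = (SUP n. (?G ^^ Suc n) g x)"
      using offspring_gf_SUP[OF inc, of \<mu> p x] by (simp add: h_def[abs_def])
    also have "\<dots> \<le> h x" unfolding h_def by (intro SUP_least SUP_upper) auto
    finally show ?thesis .
  qed

  \<comment> \<open>Comparison of \<open>u\<close> with \<open>F\<close>\<close>
  define u where "u x = 1 - h x" for x
  have hu: "h x + u x = 1" for x
    using h_le_1 by (simp add: u_def add_diff_inverse_ennreal)
  have one_le: "1 \<le> ?G h x + ?L u x" for x
    using hu by (intro one_le_offspring_gf_add_mean_op assms)
  have sub_u: "u x \<le> ?L u x" for x
  proof -
    have "1 \<le> h x + ?L u x" using one_le[of x] G_h[of x] by (meson add_right_mono order_trans)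
    then show ?thesis by (simp add: u_def ennreal_minus_le_iff)
  qed
  have u_fin: "u x < \<infinity>" for x by (auto simp: u_def less_top[symmetric])
  have u_le_F: "u x \<le> F x" for x
  proof -
    have "g x \<le> h x" unfolding h_def by (rule SUP_upper2[of 0]) auto
    then have "1 \<le> h x + F x" by (simp add: g_def ennreal_minus_le_iff add.commute)
    then show ?thesis by (simp add: u_def ennreal_minus_le_iff)
  qed

  txt \<open>
    This is \<open>u \<le> u r \<cdot> F\<^sub>n + (F - F\<^sub>n)\<close>, the second summand accounting for the lines not yet frozen at
    time \<open>n\<close>, without subtraction.
  \<close>
  have "u x + frozen \<mu> p r n x \<le> u r * frozen \<mu> p r n x + F x" for n x
  proof (induction n arbitrary: x)
    case 0
    then show ?case using u_le_F[of x] by (auto simp: indicator_def F_r)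
  next
    case (Suc n)
    show ?case
    proof (cases "x = r")
      case False
      have "u x + ?L (frozen \<mu> p r n) x \<le> ?L (\<lambda>y. u y + frozen \<mu> p r n y) x"
        unfolding mean_op_add by (intro add_mono sub_u) auto
      also have "\<dots> \<le> ?L (\<lambda>y. u r * frozen \<mu> p r n y + F y) x"
        by (intro mean_op_mono Suc)
      also have "\<dots> \<le> u r * ?L (frozen \<mu> p r n) x + F x"
        unfolding mean_op_add mean_op_cmult by (intro add_mono super_F) auto
      finally show ?thesis using False by simp
    qed (simp add: F_r)
  qed
  also have "u r * frozen \<mu> p r n x + F x \<le> u r * F x + F x" for n x
    unfolding F_def by (intro add_mono mult_left_mono SUP_upper) auto
  finally have add_F: "u x + F x \<le> u r * F x + F x" for x
    unfolding F_def by (subst ennreal_SUP_add_right) (auto intro!: SUP_least)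
  \<comment> \<open>Finiteness of \<open>F x\<close> allows its cancellation.\<close>
  have u_le: "u x \<le> u r * F x" for x
    using F_fin[of x] add_F[of x] by (auto simp: ennreal_add_left_cancel_le add.commute)

  \<comment> \<open>Propagation of the equality in \<open>r\<close>\<close>
  define A where "A = {x. u r * F x \<le> u x}"
  \<comment> \<open>On \<open>A\<close> the chain \<open>?L (u r * F) \<le> u r * F \<le> u \<le> ?L
    u \<le> ?L (u r * F)\<close> closes up, so its terms agree.\<close>
  have in_A: "?L (\<lambda>y. u r * F y) x \<le> ?L u x" "?L u x \<le> u x" if "x \<in> A" for x
  proof -
    have 1: "?L (\<lambda>y. u r * F y) x \<le> u x"
      using mult_left_mono[OF super_F[of x], of "u r"] that by (auto simp: mean_op_cmult A_def)
    from 1 sub_u[of x] show "?L (\<lambda>y. u r * F y) x \<le> ?L u x" by (rule order_trans)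
    show "?L u x \<le> u x" using mean_op_mono[OF u_le] 1 by (rule order_trans)
  qed
  have "A = UNIV"
  proof (rule irreducible_kernel_closed[OF assms(1)])
    show "r \<in> A" by (simp add: A_def F_r)
    fix x assume x: "x \<in> A"
    have "?L u x < \<infinity>" using in_A(2)[OF x] u_fin[of x] by (rule order.strict_trans1)
    then have "u z = u r * F z" if "z \<in> set_pmf (p x)" for z
      using that by (rule mean_op_eq_on_support[OF assms(2,3) u_le in_A(1)[OF x]])
    then show "set_pmf (p x) \<subseteq> A" by (auto simp: A_def)
  qed
  then have super_u: "?L u x \<le> u x" for x using in_A by auto

  \<comment> \<open>Vanishing of \<open>u\<close>\<close>
  from assms(4) obtain y where y: "1 < mean_offspring \<mu> y" by blast
  have "{x. u x = 0} = UNIV"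
  proof (rule irreducible_kernel_closed[OF assms(1)])
    have "?G h y + ?L u y \<le> h y + u y" by (intro add_mono G_h super_u)
    then have "kernel_op p u y = 0"
      using hu y
      by (intro kernel_op_eq_0[where \<mu> = \<mu> and x = y and h = h and u = u] assms(2,3)) simp_all
    then show "y \<in> {x. u x = 0}" using sub_u[of y] by (simp add: mean_op_def)
    \<comment> \<open>Zeros spread along \<open>p\<close>: at \<open>x\<close> the functions
      \<open>0\<close> and \<open>u\<close> have the same image under \<open>?L\<close>, so they
      agree on the support of \<open>p x\<close>.\<close>
    fix x assume "x \<in> {x. u x = 0}"
    then have "?L u x = 0" using super_u[of x] by simp
    then have "0 = u z" if "z \<in> set_pmf (p x)" for z
      using that
      by (intro mean_op_eq_on_support[where \<mu> = \<mu> and x = x and f = "\<lambda>_. 0" and g = u and p = p]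
          assms(2,3)) (auto simp: mean_op_def[of _ _ "\<lambda>_. 0"] kernel_op_def)
    then show "set_pmf (p x) \<subseteq> {x. u x = 0}" by auto
  qed
  then have "u r = 0" by auto
  then have "1 \<le> ennreal (1 - bmc_alpha \<mu> p r)"
    using hu[of r] h_le_alpha by simp
  then show "bmc_alpha \<mu> p r = 0"
    unfolding bmc_alpha_def by (simp add: measure_nonneg antisym)
qed

end
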